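(* For the OWNM problem, no randomized online algorithm can achieve a competitive ratio better than $16/17$ in expectation (this holds already when all weights equal $1$).
   Context: Online Weighted Non-Crossing Matching (OWNM): the input is a sequence $p_1,\dots,p_{2n}$ of points in the Euclidean plane in general position, revealed online one at a time; when $p_i$ arrives its weight $w(p_i)>0$ is revealed. Upon arrival of $p_i$ an online algorithm must irrevocably either leave $p_i$ unmatched or match it with a previously arrived, currently unmatched point, subject to the constraint that the straight-line segments joining matched pairs are pairwise non-crossing. The profit $\textsc{ALG}(I)$ is the total weight of matched points, and $\textsc{OPT}(I)=\sum_i w(p_i)$. A randomized algorithm is $\rho$-competitive if there is a constant $c$ such that $\mathbb{E}[\textsc{ALG}(I)]\ge\rho\,\textsc{OPT}(I)-c$ for all inputs $I$; its competitive ratio is the supremum of such $\rho$. *)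

theory Defs
  imports "HOL-Probability.Probability"
begin

text \<open>An instance lists the arriving points of the plane together with their weights.\<close>

type_synonym instance_seq = "((real \<times> real) \<times> real) list"

abbreviation pt :: "instance_seq \<Rightarrow> nat \<Rightarrow> real \<times> real" where
  "pt I i \<equiv> fst (I ! i)"

abbreviation wt :: "instance_seq \<Rightarrow> nat \<Rightarrow> real" where
  "wt I i \<equiv> snd (I ! i)"

definition general_position :: "instance_seq \<Rightarrow> bool" where
  "general_position I \<longleftrightarrow>
     distinct (map fst I) \<and>
     (\<forall>i<length I. \<forall>j<length I. \<forall>k<length I.
        i \<noteq> j \<and> j \<noteq> k \<and> i \<noteq> k \<longrightarrow> \<not> collinear {pt I i, pt I j, pt I k})"

definition ownm_inputs :: "instance_seq set" where
  "ownm_inputs = {I. even (length I) \<and> general_position I \<and> (\<forall>i<length I. wt I i > 0)}"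

definition unit_weight_inputs :: "instance_seq set" where
  "unit_weight_inputs = {I \<in> ownm_inputs. \<forall>i<length I. wt I i = 1}"

text \<open>
  A deterministic online algorithm maps the nonempty prefix revealed so far, whose last entry is
  the point that has just arrived, to its decision: \<open>None\<close> leaves the new point unmatched (for
  now), and \<open>Some j\<close> matches it with the point at position \<open>j\<close> (counting from 0). Its own earlier
  decisions need not be passed to it, being determined by the shorter prefixes. The total number of
  points is not revealed.
\<close>

type_synonym online_algorithm = "instance_seq \<Rightarrow> nat option"

definition matching :: "online_algorithm \<Rightarrow> instance_seq \<Rightarrow> (nat \<times> nat) set" where
  "matching A I = {(j, i). i < length I \<and> A (take (Suc i) I) = Some j}"

text \<open>
  For distinct pairs of points in general position without a common endpoint, the two closed
  segments meet exactly if they cross in their relative interiors.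
\<close>

definition crossing :: "instance_seq \<Rightarrow> nat \<times> nat \<Rightarrow> nat \<times> nat \<Rightarrow> bool" where
  "crossing I e f \<longleftrightarrow>
     closed_segment (pt I (fst e)) (pt I (snd e)) \<inter>
     closed_segment (pt I (fst f)) (pt I (snd f)) \<noteq> {}"

definition feasible :: "online_algorithm \<Rightarrow> instance_seq \<Rightarrow> bool" where
  "feasible A I \<longleftrightarrow>
     (\<forall>(j, i) \<in> matching A I. j < i) \<and>
     (\<forall>e \<in> matching A I. \<forall>f \<in> matching A I. e \<noteq> f \<longrightarrow>
        {fst e, snd e} \<inter> {fst f, snd f} = {} \<and> \<not> crossing I e f)"

definition matched :: "online_algorithm \<Rightarrow> instance_seq \<Rightarrow> nat set" where
  "matched A I = (\<Union>(j, i) \<in> matching A I. {j, i})"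

definition profit :: "online_algorithm \<Rightarrow> instance_seq \<Rightarrow> real" where
  "profit A I = (\<Sum>i \<in> matched A I. wt I i)"

definition opt :: "instance_seq \<Rightarrow> real" where
  "opt I = (\<Sum>i<length I. wt I i)"

text \<open>
  A randomized algorithm for the inputs in \<open>\<I>\<close> is a family of feasible deterministic algorithms
  indexed by the outcomes of an arbitrary probability space, each decision being a random variable.
\<close>

definition randomized_online_algorithm ::
  "instance_seq set \<Rightarrow> 'r measure \<Rightarrow> ('r \<Rightarrow> online_algorithm) \<Rightarrow> bool" where
  "randomized_online_algorithm \<I> M A \<longleftrightarrow>
     prob_space M \<and>
     (\<forall>I \<in> \<I>. \<forall>\<omega> \<in> space M. feasible (A \<omega>) I) \<and>
     (\<forall>I \<in> \<I>. \<forall>i<length I. (\<lambda>\<omega>. A \<omega> (take (Suc i) I)) \<in> measurable M (count_space UNIV))"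

definition competitive ::
  "instance_seq set \<Rightarrow> 'r measure \<Rightarrow> ('r \<Rightarrow> online_algorithm) \<Rightarrow> real \<Rightarrow> bool" where
  "competitive \<I> M A \<rho> \<longleftrightarrow>
     (\<exists>c. \<forall>I \<in> \<I>. (\<integral>\<omega>. profit (A \<omega>) I \<partial>M) \<ge> \<rho> * opt I - c)"

definition competitive_ratio ::
  "instance_seq set \<Rightarrow> 'r measure \<Rightarrow> ('r \<Rightarrow> online_algorithm) \<Rightarrow> ereal" where
  "competitive_ratio \<I> M A = (SUP \<rho> \<in> {\<rho>. competitive \<I> M A \<rho>}. ereal \<rho>)"

end

theory Submission
  imports Defs
begin

text \<open>
  By Yao's principle it suffices to find a random input that is bad for every deterministic
  algorithm. All points lie on a parabola, so that two chords cross exactly if their parameters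
  interleave. Each point is placed in the current gap between earlier points, and the next gap is
  one of its two sides, chosen at random; the other side is occasionally revisited once. Matching
  the new point separates its two sides, so free points on the side that is not continued, and a
  point that is placed there alone, are lost. Leaving it unmatched lets free points accumulate,
  and a later chord then separates them. A linear potential in the numbers of free and of visible
  points shows that at least one point in nine is lost on average, whence even the bound 8/9.
\<close>

section \<open>Chords on a parabola, free points and visibility\<close>

definition inside :: "real \<Rightarrow> real \<Rightarrow> real \<Rightarrow> bool" where
  "inside u v t \<longleftrightarrow> min u v < t \<and> t < max u v"

text \<open>If \<open>s\<close> and \<open>t\<close> are distinct and not endpoints of chords in
  \<open>M\<close>, then this says that the chord joining them on the parabola crosses none of these
  chords.\<close>

definition same_side :: "(real \<times> real) set \<Rightarrow> real \<Rightarrow> real \<Rightarrow> bool" where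
  "same_side M s t \<longleftrightarrow> (\<forall>(u, v) \<in> M. inside u v s = inside u v t)"

definition free :: "real set \<Rightarrow> (real \<times> real) set \<Rightarrow> real set" where
  "free P M = P - fst ` M - snd ` M"

definition visible :: "real set \<Rightarrow> (real \<times> real) set \<Rightarrow> real \<Rightarrow> real set" where
  "visible P M t = {p \<in> free P M. same_side M p t}"

lemma same_side_refl [simp]: "same_side M t t"
  by (auto simp: same_side_def)

lemma same_side_sym: "same_side M s t \<Longrightarrow> same_side M t s"
  by (auto simp: same_side_def)

lemma same_side_trans: "same_side M r s \<Longrightarrow> same_side M s t \<Longrightarrow> same_side M r t"
  by (fastforce simp: same_side_def)

text \<open>No chord ends inside the gap, so none can separate two of its points. Any point of a
  gap, such as its midpoint, may thus represent the whole gap.\<close>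

lemma same_side_gap:
  assumes "M \<subseteq> P \<times> P" "{l<..<r} \<inter> P = {}" "s \<in> {l<..<r}" "t \<in> {l<..<r}"
  shows "same_side M s t"
proof -
  have "inside u v s = inside u v t" if "(u, v) \<in> M" for u v
  proof -
    have "u \<notin> {l<..<r}" "v \<notin> {l<..<r}"
      using assms(1,2) that by auto
    with assms(3,4) show ?thesis
      by (auto simp: inside_def min_def max_def)
  qed
  thus ?thesis by (auto simp: same_side_def)
qed

lemma visible_cong: "same_side M s t \<Longrightarrow> visible P M s = visible P M t"
  by (auto simp: visible_def intro: same_side_trans same_side_sym)

lemma same_side_insert_iff:
  "same_side (insert (q, y) M) s t \<longleftrightarrow> inside q y s = inside q y t \<and> same_side M s t"
  by (auto simp: same_side_def)

lemma free_subset: "free P M \<subseteq> P" and visible_subset: "visible P M t \<subseteq> free P M"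
  by (auto simp: free_def visible_def)

lemma free_insert_point:
  assumes "M \<subseteq> P \<times> P" "y \<notin> P"
  shows "free (insert y P) M = insert y (free P M)"
  using assms by (force simp: free_def)

lemma free_insert_chord:
  assumes "q \<in> P" "y \<notin> P"
  shows "free (insert y P) (insert (q, y) M) = free P M - {q}"
  using assms by (auto simp: free_def)

lemma visible_insert_point:
  assumes "M \<subseteq> P \<times> P" "y \<notin> P"
  shows "visible (insert y P) M t = (if same_side M y t then insert y (visible P M t) else visible P M t)"
  using assms by (auto simp: visible_def free_insert_point)

lemma visible_insert_chord:
  assumes "q \<in> P" "y \<notin> P"
  shows "visible (insert y P) (insert (q, y) M) t =
    {p \<in> visible P M t - {q}. inside q y p = inside q y t}"
  using assms by (auto simp: visible_def free_insert_chord same_side_insert_iff)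

section \<open>The potential and its gain in one step\<close>

text \<open>
  Nine times a lower bound, up to an additive constant, for the expected final number of free
  points, less the number of points still to arrive. Free points that are visible from neither of
  the places where the adversary may continue are lost for good. The weights solve the linear
  program that says that the potential gains at least 1 per point, whatever the algorithm does.
\<close>

definition potential :: "real set \<Rightarrow> (real \<times> real) set \<Rightarrow> real \<Rightarrow> real option \<Rightarrow> real" where
  "potential P M t so =
     9 * real (card (free P M)) +
     (case so of
        None \<Rightarrow> - 8 * real (card (visible P M t))
      | Some s \<Rightarrow>
          if same_side M t s then - 8 * real (card (visible P M t))
          else 4 - 12 * real (card (visible P M t)) - 4 * real (card (visible P M s)))"

text \<open>The two claims serve the adversary without and with a remembered gap; in the second,
  \<open>s\<close> stands for that gap. No chord is added, so both sides of \<open>y\<close> see the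
  same points, and one more free point that is also visible changes the potential by 9 - 8 =
  1.\<close>

lemma potential_step_unmatched:
  assumes P: "finite P" and M: "M \<subseteq> P \<times> P" and gap: "{l<..<r} \<inter> P = {}"
    and y: "y \<in> {l<..<r}" and t: "t \<in> {l<..<r}" and t': "t' \<in> {l<..<r}"
  shows "potential (insert y P) M t (Some t') = potential P M y None + 1"
    and "potential (insert y P) M s None / 2 + (potential P M y None + 1) / 2
          \<ge> potential P M y (Some s) + 1"
proof -
  have yP: "y \<notin> P" using gap y by auto
  note fin = finite_subset[OF free_subset P] finite_subset[OF visible_subset finite_subset[OF free_subset P]]
  have ny: "y \<notin> free P M" "\<And>z. y \<notin> visible P M z"
    using yP by (auto simp: free_def visible_def)
  have yt: "same_side M y t" "same_side M t t'"
    using same_side_gap[OF M gap] y t t' by auto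
  have cf: "card (free (insert y P) M) = card (free P M) + 1"
    using free_insert_point[OF M yP] fin ny by simp
  have ct: "card (visible (insert y P) M t) = card (visible P M y) + 1"
    using visible_insert_point[OF M yP, of t] yt visible_cong[OF yt(1), of P] fin ny by simp
  show "potential (insert y P) M t (Some t') = potential P M y None + 1"
    using cf ct yt by (simp add: potential_def)
  show "potential (insert y P) M s None / 2 + (potential P M y None + 1) / 2
          \<ge> potential P M y (Some s) + 1"
  proof (cases "same_side M y s")
    case True
    hence "card (visible (insert y P) M s) = card (visible P M y) + 1"
      using visible_insert_point[OF M yP, of s] visible_cong[OF True, of P] fin ny by simp
    thus ?thesis using True cf by (simp add: potential_def field_simps)
  next
    \<comment> \<open>Let F count the free points and V(z) those visible from z, before the step.
      The left side is 9F + 5 - 4V(y) - 4V(s), ahead of the right side by 8V(y).\<close>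
    case False
    hence "card (visible (insert y P) M s) = card (visible P M s)"
      using visible_insert_point[OF M yP, of s] by simp
    thus ?thesis using False cf by (simp add: potential_def field_simps)
  qed
qed

text \<open>The new chord separates the two sides of \<open>y\<close>, and each remaining visible
  point is seen from at most one of them. Narrowing therefore gains 3, and the surplus over 1 pays
  for a jump to \<open>s\<close>.\<close>

lemma potential_step_matched:
  assumes P: "finite P" and M: "M \<subseteq> P \<times> P" and gap: "{l<..<r} \<inter> P = {}"
    and y: "y \<in> {l<..<r}" and t: "t \<in> {l<..<y}" and t': "t' \<in> {y<..<r}"
    and q: "q \<in> visible P M y"
  defines "P' \<equiv> insert y P" and "M' \<equiv> insert (q, y) M"
  shows "(potential P' M' t (Some t') + potential P' M' t' (Some t)) / 2 \<ge> potential P M y None + 3"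
    and "potential P' M' s None / 2 + (potential P' M' t (Some t') + potential P' M' t' (Some t)) / 4
          \<ge> potential P M y (Some s) + 1"
proof -
  have yP: "y \<notin> P" using gap y by auto
  have qf: "q \<in> free P M" and qP: "q \<in> P"
    using q free_subset by (auto simp: visible_def)
  \<comment> \<open>Since \<open>q\<close> lies outside the gap, the chord from \<open>q\<close> to
    \<open>y\<close> covers exactly one of the two halves of the gap.\<close>
  have "q \<notin> {l<..<r}" using gap qP by auto
  hence sep: "inside q y t \<noteq> inside q y t'"
    using y t t' by (auto simp: inside_def)
  hence sep': "\<not> same_side M' t t'" "\<not> same_side M' t' t"
    by (auto simp: M'_def same_side_insert_iff)
  have st: "same_side M t y" "same_side M t' y"
    using same_side_gap[OF M gap] y t t' by auto
  note fin = finite_subset[OF free_subset P] finite_subset[OF visible_subset finite_subset[OF free_subset P]]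
  have pos: "card (free P M) > 0" "card (visible P M y) > 0"
    using fin qf q by (auto simp: card_gt_0_iff)
  have cf: "card (free P' M') = card (free P M) - 1"
    unfolding P'_def M'_def using free_insert_chord[OF qP yP] qf fin by simp
  have V: "visible P' M' z = {p \<in> visible P M z - {q}. inside q y p = inside q y z}" for z
    unfolding P'_def M'_def by (rule visible_insert_chord[OF qP yP])
  have "card (visible P' M' t) + card (visible P' M' t') = card (visible P' M' t \<union> visible P' M' t')"
    using sep by (subst card_Un_disjoint) (auto simp: V fin)
  also have "\<dots> \<le> card (visible P M y - {q})"
    using visible_cong[OF st(1), of P] visible_cong[OF st(2), of P]
    by (intro card_mono) (auto simp: V fin)
  also have "\<dots> = card (visible P M y) - 1"
    using q fin by simp
  finally have sum: "real (card (visible P' M' t)) + card (visible P' M' t') \<le> real (card (visible P M y)) - 1"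
    using pos by linarith
  have cf': "real (card (free P' M')) = real (card (free P M)) - 1"
    using cf pos by linarith
  \<comment> \<open>Averaging the two orders turns the weights 12 and 4 into 8 on each side. With F
    and V(y) counted before the step, this gives at least 9(F - 1) + 4 - 8(V(y) - 1) = 9F - 8V(y) +
    3.\<close>
  show 1: "(potential P' M' t (Some t') + potential P' M' t' (Some t)) / 2 \<ge> potential P M y None + 3"
    using sep' sum cf' by (simp add: potential_def)
  have y_None: "potential P M y None = 9 * real (card (free P M)) - 8 * real (card (visible P M y))"
    by (simp add: potential_def)
  have s_None: "potential P' M' s None = 9 * real (card (free P M)) - 9 - 8 * real (card (visible P' M' s))"
    using cf' by (simp add: potential_def)
  have vs: "card (visible P' M' s) \<le> card (visible P M s - {q})"
    by (intro card_mono) (auto simp: V fin)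
  show "potential P' M' s None / 2 + (potential P' M' t (Some t') + potential P' M' t' (Some t)) / 4
          \<ge> potential P M y (Some s) + 1"
  proof (cases "same_side M y s")
    case True
    with vs have "card (visible P' M' s) \<le> card (visible P M y) - 1"
      using visible_cong[OF True, of P] q fin by simp
    hence "real (card (visible P' M' s)) \<le> real (card (visible P M y)) - 1"
      using pos by linarith
    moreover have "potential P M y (Some s) = potential P M y None"
      using True by (simp add: potential_def)
    \<comment> \<open>The jump loses at most 1 and narrowing gains at least 3, so the average gain
      is at least 1.\<close>
    ultimately show ?thesis using 1 s_None y_None by linarith
  next
    case False
    have "card (visible P M s - {q}) \<le> card (visible P M s)"
      by (intro card_mono fin) auto
    with vs have "real (card (visible P' M' s)) \<le> card (visible P M s)"
      by linarith
    moreover have "potential P M y (Some s) = 9 * real (card (free P M)) + 4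
        - 12 * real (card (visible P M y)) - 4 * real (card (visible P M s))"
      using False by (simp add: potential_def)
    \<comment> \<open>The left side is at least 9F - 3 - 4V(y) - 4V(s), which exceeds the right side
      by 8(V(y) - 1). The partner \<open>q\<close> is visible, so this is nonnegative.\<close>
    moreover have "real (card (visible P M y)) \<ge> 1"
      using pos by linarith
    ultimately show ?thesis using 1 s_None y_None by linarith
  qed
qed

section \<open>The random adversary\<close>

text \<open>
  The value of a function of the final sequence, averaged over the choices of a random adversary
  that always places the next point in the middle of the current gap and then narrows the gap to
  a random side of that point. Right after such a narrowing the other side is remembered for one
  step: with probability 1/2 the adversary jumps there instead of narrowing again.
\<close>

fun adversary_value ::
  "nat \<Rightarrow> (real list \<Rightarrow> real) \<Rightarrow> real list \<Rightarrow> real \<times> real \<Rightarrow> (real \<times> real) option \<Rightarrow> real" where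
  "adversary_value 0 f xs G B = f xs"
| "adversary_value (Suc n) f xs (l, r) B =
     (let y = (l + r) / 2; ys = xs @ [y];
          narrow = (adversary_value n f ys (l, y) (Some (y, r)) +
                    adversary_value n f ys (y, r) (Some (l, y))) / 2
      in case B of None \<Rightarrow> narrow | Some H \<Rightarrow> (adversary_value n f ys H None + narrow) / 2)"

definition is_gap :: "real list \<Rightarrow> real \<times> real \<Rightarrow> bool" where
  "is_gap xs G \<longleftrightarrow> fst G < snd G \<and> {fst G<..<snd G} \<inter> set xs = {}"

definition game_state :: "real list \<Rightarrow> real \<times> real \<Rightarrow> (real \<times> real) option \<Rightarrow> bool" where
  "game_state xs G B \<longleftrightarrow>
     distinct xs \<and> is_gap xs G \<and>
     (\<forall>H. B = Some H \<longrightarrow> is_gap xs H \<and> {fst G<..<snd G} \<inter> {fst H<..<snd H} = {})"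

lemma game_state_next:
  assumes "game_state xs (l, r) B"
  defines "y \<equiv> (l + r) / 2"
  shows "game_state (xs @ [y]) (l, y) (Some (y, r))"
    and "game_state (xs @ [y]) (y, r) (Some (l, y))"
    and "B = Some H \<Longrightarrow> game_state (xs @ [y]) H None"
    and "l < y" "y < r" "y \<notin> set xs"
proof -
  have *: "distinct xs" "l < r" "{l<..<r} \<inter> set xs = {}"
    using assms(1) by (auto simp: game_state_def is_gap_def)
  show ly: "l < y" "y < r" using * by (auto simp: y_def)
  show yx: "y \<notin> set xs" using * ly by auto
  have "{l<..<y} \<inter> set xs = {}" "{y<..<r} \<inter> set xs = {}"
    using *(3) ly by (meson disjoint_iff greaterThanLessThan_iff less_trans)+
  thus "game_state (xs @ [y]) (l, y) (Some (y, r))" "game_state (xs @ [y]) (y, r) (Some (l, y))"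
    using *(1) ly yx by (simp_all add: game_state_def is_gap_def disjoint_iff)
  show "game_state (xs @ [y]) H None" if "B = Some H"
  proof -
    \<comment> \<open>The remembered gap is disjoint from the current one, so \<open>y\<close> falls
      outside it and it remains a gap.\<close>
    have "y \<in> {l<..<r}" using ly by auto
    thus ?thesis
      using assms(1) that yx by (auto simp: game_state_def is_gap_def)
  qed
qed

text \<open>The value is an average over sequences that are all distinct and of the same length,
  because the game state is preserved. Hence a bound on these legal inputs suffices.\<close>

lemma adversary_value_le:
  assumes "game_state xs G B"
    and "\<And>ys. distinct ys \<Longrightarrow> length ys = length xs + n \<Longrightarrow> f ys \<le> c"
  shows "adversary_value n f xs G B \<le> c"
  using assms
proof (induction n arbitrary: xs G B)
  case 0
  thus ?case by (simp add: game_state_def)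
next
  case (Suc n)
  obtain l r where G: "G = (l, r)" by fastforce
  define y where "y = (l + r) / 2"
  note st = game_state_next[OF Suc.prems(1)[unfolded G], folded y_def]
  have IH: "adversary_value n f (xs @ [y]) G' B' \<le> c" if "game_state (xs @ [y]) G' B'" for G' B'
    using Suc.prems(2) that by (intro Suc.IH) simp_all
  note le = IH[OF st(1)] IH[OF st(2)]
  show ?case
  proof (cases B)
    case None
    thus ?thesis using le by (simp add: G Let_def flip: y_def)
  next
    case (Some H)
    have "adversary_value n f (xs @ [y]) H None \<le> c"
      by (intro IH st(3) Some)
    thus ?thesis using le Some by (simp add: G Let_def field_simps flip: y_def)
  qed
qed

text \<open>The exchange of averages in Yao's principle: the adversary's average is finite, so it
  commutes with the expectation over the algorithm's randomness.\<close>

lemma adversary_value_integral: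
  assumes "game_state xs G B" and "\<And>ys. distinct ys \<Longrightarrow> length ys = length xs + n \<Longrightarrow> integrable M (g ys)"
  shows "integrable M (\<lambda>\<omega>. adversary_value n (\<lambda>ys. g ys \<omega>) xs G B) \<and>
    (\<integral>\<omega>. adversary_value n (\<lambda>ys. g ys \<omega>) xs G B \<partial>M) =
      adversary_value n (\<lambda>ys. \<integral>\<omega>. g ys \<omega> \<partial>M) xs G B"
  using assms
proof (induction n arbitrary: xs G B)
  case 0
  thus ?case by (simp add: game_state_def)
next
  case (Suc n)
  obtain l r where G: "G = (l, r)" by fastforce
  define y where "y = (l + r) / 2"
  note st = game_state_next[OF Suc.prems(1)[unfolded G], folded y_def]
  have int: "integrable M (g ys)" if "distinct ys" "length ys = length (xs @ [y]) + n" for ys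
    using Suc.prems(2) that by simp
  note IH = Suc.IH[OF st(1) int] Suc.IH[OF st(2) int] Suc.IH[OF st(3) int]
  show ?case
    using IH by (cases B) (simp_all add: G Let_def y_def[symmetric])
qed

section \<open>Geometry of the parabola\<close>

definition parabola_instance :: "real list \<Rightarrow> instance_seq" where
  "parabola_instance xs = map (\<lambda>t. ((t, t\<^sup>2), 1)) xs"

lemma length_parabola_instance [simp]: "length (parabola_instance xs) = length xs"
  and pt_parabola_instance [simp]: "i < length xs \<Longrightarrow> pt (parabola_instance xs) i = (xs ! i, (xs ! i)\<^sup>2)"
  and wt_parabola_instance [simp]: "i < length xs \<Longrightarrow> wt (parabola_instance xs) i = 1"
  and take_parabola_instance: "take k (parabola_instance xs) = parabola_instance (take k xs)"
  by (simp_all add: parabola_instance_def take_map)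

lemma not_collinear_parabola:
  fixes a b c :: real
  assumes "a \<noteq> b" "b \<noteq> c" "a \<noteq> c"
  shows "\<not> collinear {(a, a\<^sup>2), (b, b\<^sup>2), (c, c\<^sup>2)}"
proof
  assume "collinear {(a, a\<^sup>2), (b, b\<^sup>2), (c, c\<^sup>2)}"
  then obtain u :: "real \<times> real" where
    u: "\<forall>x\<in>{(a, a\<^sup>2), (b, b\<^sup>2), (c, c\<^sup>2)}. \<forall>y\<in>{(a, a\<^sup>2), (b, b\<^sup>2), (c, c\<^sup>2)}. \<exists>k. x - y = k *\<^sub>R u"
    unfolding collinear_def by blast
  obtain k m where "(b, b\<^sup>2) - (a, a\<^sup>2) = k *\<^sub>R u" "(c, c\<^sup>2) - (a, a\<^sup>2) = m *\<^sub>R u"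
    using u by blast
  hence k: "b - a = k * fst u" "b\<^sup>2 - a\<^sup>2 = k * snd u" and m: "c - a = m * fst u" "c\<^sup>2 - a\<^sup>2 = m * snd u"
    by (cases u; simp)+
  have "(b - a) * (c\<^sup>2 - a\<^sup>2) = (c - a) * (b\<^sup>2 - a\<^sup>2)"
    unfolding k m by simp
  \<comment> \<open>Eliminating the common direction leaves the Vandermonde determinant of
    \<open>a\<close>, \<open>b\<close>, \<open>c\<close>.\<close>
  hence "(b - a) * (c - a) * (c - b) = 0"
    by algebra
  thus False using assms by simp
qed

lemma parabola_instance_inputs:
  assumes "distinct xs" "even (length xs)"
  shows "parabola_instance xs \<in> unit_weight_inputs"
proof -
  have "distinct (map fst (parabola_instance xs))"
    using assms(1) by (simp add: parabola_instance_def distinct_map inj_on_def)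
  moreover have "\<not> collinear {pt (parabola_instance xs) i, pt (parabola_instance xs) j, pt (parabola_instance xs) k}"
    if "i < length xs" "j < length xs" "k < length xs" "i \<noteq> j" "j \<noteq> k" "i \<noteq> k" for i j k
    using not_collinear_parabola[of "xs ! i" "xs ! j" "xs ! k"] that assms(1)
    by (simp add: nth_eq_iff_index_eq)
  ultimately show ?thesis
    using assms(2) by (simp add: unit_weight_inputs_def ownm_inputs_def general_position_def)
qed

lemma parabola_chord_point:
  fixes a c x :: real
  assumes "a < c" "a \<le> x" "x \<le> c"
  shows "(x, (a + c) * x - a * c) \<in> closed_segment (a, a\<^sup>2) (c, c\<^sup>2)"
proof -
  define k where "k = (x - a) / (c - a)"
  have k: "k * (c - a) = x - a" "0 \<le> k" "k \<le> 1"
    using assms by (auto simp: k_def)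
  have "x = (1 - k) * a + k * c"
    using k(1) by (simp add: algebra_simps)
  moreover have "(a + c) * x - a * c = (1 - k) * a\<^sup>2 + k * c\<^sup>2"
    using k(1) by algebra
  ultimately show ?thesis
    using k(2,3) unfolding closed_segment_def by auto
qed

lemma parabola_chords_meet:
  fixes a b c d :: real
  assumes "a < b" "b < c" "c < d"
  shows "closed_segment (a, a\<^sup>2) (c, c\<^sup>2) \<inter> closed_segment (b, b\<^sup>2) (d, d\<^sup>2) \<noteq> {}"
proof -
  \<comment> \<open>The abscissa at which the two lines with equations (a + c) x - a c and (b + d) x
    - b d meet.\<close>
  define x where "x = (b * d - a * c) / (b + d - a - c)"
  have pos: "b + d - a - c > 0" using assms by simp
  have x: "(a + c) * x - a * c = (b + d) * x - b * d"
    using pos by (simp add: x_def field_simps)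
  \<comment> \<open>After clearing the denominator, \<open>b\<close> \<le> \<open>x\<close> and
    \<open>x\<close> \<le> \<open>c\<close> say that these products are nonnegative.\<close>
  have "(b - a) * (c - b) > 0" "(d - c) * (c - b) > 0"
    using assms by simp_all
  hence "b \<le> x" "x \<le> c"
    using pos by (simp_all add: x_def field_simps)
  hence "(x, (a + c) * x - a * c) \<in> closed_segment (a, a\<^sup>2) (c, c\<^sup>2)"
    "(x, (a + c) * x - a * c) \<in> closed_segment (b, b\<^sup>2) (d, d\<^sup>2)"
    using parabola_chord_point[of a c x] parabola_chord_point[of b d x] assms
    unfolding x by simp_all
  thus ?thesis by blast
qed

lemma parabola_chords_separated:
  fixes u v p q :: real
  assumes disj: "closed_segment (u, u\<^sup>2) (v, v\<^sup>2) \<inter> closed_segment (p, p\<^sup>2) (q, q\<^sup>2) = {}"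
    and ne: "u \<noteq> p" "u \<noteq> q" "v \<noteq> p" "v \<noteq> q"
  shows "inside u v p = inside u v q"
proof (rule ccontr)
  assume "inside u v p \<noteq> inside u v q"
  moreover define a b where "a = min u v" and "b = max u v"
  \<comment> \<open>By \<open>ne\<close> the endpoint that is not inside lies strictly outside, so
    the four parameters interleave in one of four orders.\<close>
  ultimately have ab: "a < p \<and> p < b \<and> (q < a \<or> b < q) \<or> a < q \<and> q < b \<and> (p < a \<or> b < p)"
    using ne by (auto simp: inside_def min_def max_def split: if_splits)
  have "closed_segment (a, a\<^sup>2) (b, b\<^sup>2) \<inter> closed_segment (p, p\<^sup>2) (q, q\<^sup>2) = {}"
    using disj by (auto simp: a_def b_def min_def max_def closed_segment_commute)
  thus False
    using ab parabola_chords_meet[of a p b q] parabola_chords_meet[of q a p b]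
      parabola_chords_meet[of a q b p] parabola_chords_meet[of p a q b]
    by (auto simp: closed_segment_commute Int_commute)
qed

section \<open>From an online algorithm to its chords\<close>

definition chords :: "online_algorithm \<Rightarrow> real list \<Rightarrow> (real \<times> real) set" where
  "chords A xs = (\<lambda>(j, i). (xs ! j, xs ! i)) ` matching A (parabola_instance xs)"

definition feasible_on_parabola :: "online_algorithm \<Rightarrow> bool" where
  "feasible_on_parabola A \<longleftrightarrow> (\<forall>xs. distinct xs \<longrightarrow> feasible A (parabola_instance xs))"

lemma matching_snoc:
  "matching A (parabola_instance (xs @ [y])) =
    matching A (parabola_instance xs) \<union> {(j, length xs) |j. A (parabola_instance (xs @ [y])) = Some j}"
  by (auto simp: matching_def take_parabola_instance less_Suc_eq)

lemma matching_lessD: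
  assumes "feasible A (parabola_instance xs)" "(j, i) \<in> matching A (parabola_instance xs)"
  shows "j < i" "i < length xs"
  using assms by (auto simp: feasible_def matching_def)

lemma feasibleD:
  assumes "feasible A I" "(j, i) \<in> matching A I" "(j', i') \<in> matching A I" "(j, i) \<noteq> (j', i')"
  shows "{j, i} \<inter> {j', i'} = {}" "\<not> crossing I (j, i) (j', i')"
  using conjunct2[OF assms(1)[unfolded feasible_def], rule_format, OF assms(2-4)] by simp_all

lemma crossing_parabola_instance:
  assumes "j < length xs" "i < length xs" "j' < length xs" "i' < length xs"
  shows "crossing (parabola_instance xs) (j, i) (j', i') \<longleftrightarrow>
    closed_segment (xs ! j, (xs ! j)\<^sup>2) (xs ! i, (xs ! i)\<^sup>2) \<inter>
    closed_segment (xs ! j', (xs ! j')\<^sup>2) (xs ! i', (xs ! i')\<^sup>2) \<noteq> {}"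
  using assms by (simp add: crossing_def)

lemma feasible_butlast:
  assumes "feasible A (parabola_instance (xs @ [y]))"
  shows "feasible A (parabola_instance xs)"
proof -
  let ?M = "matching A (parabola_instance xs)"
  have sub: "?M \<subseteq> matching A (parabola_instance (xs @ [y]))"
    by (auto simp: matching_snoc)
  have less: "j < i" "i < length xs" if "(j, i) \<in> ?M" for j i
    using matching_lessD[OF assms] that sub by (auto simp: matching_def)
  have *: "{j, i} \<inter> {j', i'} = {} \<and> \<not> crossing (parabola_instance xs) (j, i) (j', i')"
    if e: "(j, i) \<in> ?M" and f: "(j', i') \<in> ?M" and "(j, i) \<noteq> (j', i')" for j i j' i'
  proof -
    have "\<not> crossing (parabola_instance (xs @ [y])) (j, i) (j', i')" "{j, i} \<inter> {j', i'} = {}"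
      using feasibleD[OF assms] that sub by blast+
    thus ?thesis
      using less[OF e] less[OF f] by (simp add: crossing_parabola_instance nth_append)
  qed
  show ?thesis
    unfolding feasible_def
  proof (intro conjI ballI impI)
    fix e f assume "e \<in> ?M" "f \<in> ?M" "e \<noteq> f"
    thus "{fst e, snd e} \<inter> {fst f, snd f} = {}" "\<not> crossing (parabola_instance xs) e f"
      using *[of "fst e" "snd e" "fst f" "snd f"] unfolding prod.collapse by blast+
  next
    fix e assume "e \<in> ?M"
    thus "case e of (j, i) \<Rightarrow> j < i"
      using less(1) by (cases e) simp
  qed
qed

text \<open>Inputs have even length, but the game passes through odd lengths too. An odd sequence is
  extended by a fresh parameter, and feasibility is inherited by the prefix.\<close>

lemma feasible_on_parabolaI:
  assumes "\<And>I. I \<in> unit_weight_inputs \<Longrightarrow> feasible A I"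
  shows "feasible_on_parabola A"
  unfolding feasible_on_parabola_def
proof (intro allI impI)
  fix xs :: "real list"
  assume xs: "distinct xs"
  show "feasible A (parabola_instance xs)"
  proof (cases "even (length xs)")
    case True
    thus ?thesis using assms parabola_instance_inputs xs by blast
  next
    case False
    obtain y where "y \<notin> set xs"
      using ex_new_if_finite[OF infinite_UNIV_char_0] by blast
    with False xs have "parabola_instance (xs @ [y]) \<in> unit_weight_inputs"
      by (intro parabola_instance_inputs) auto
    thus ?thesis using assms feasible_butlast by blast
  qed
qed

lemma chords_subset:
  assumes "feasible_on_parabola A" "distinct xs"
  shows "chords A xs \<subseteq> set xs \<times> set xs"
proof -
  have "feasible A (parabola_instance xs)"
    using assms by (simp add: feasible_on_parabola_def)
  thus ?thesis
    using matching_lessD by (fastforce simp: chords_def)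
qed

lemma chords_old:
  assumes "feasible_on_parabola A" "distinct xs"
  shows "(\<lambda>(j, i). ((xs @ [y]) ! j, (xs @ [y]) ! i)) ` matching A (parabola_instance xs) = chords A xs"
proof -
  have "feasible A (parabola_instance xs)"
    using assms by (simp add: feasible_on_parabola_def)
  note less = matching_lessD[OF this]
  have "j < length xs" "i < length xs" if "(j, i) \<in> matching A (parabola_instance xs)" for j i
    using less[OF that] by auto
  thus ?thesis
    unfolding chords_def by (intro image_cong refl) (auto simp: nth_append)
qed

lemma chords_snoc_None:
  assumes "feasible_on_parabola A" "distinct xs" "A (parabola_instance (xs @ [y])) = None"
  shows "chords A (xs @ [y]) = chords A xs"
  using chords_old[OF assms(1,2), of y] assms(3) by (simp add: chords_def[of A "xs @ [y]"] matching_snoc)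

text \<open>The partner is visible because feasibility excludes shared endpoints, which makes it
  free, and crossings, so that no earlier chord separates it from \<open>y\<close>.\<close>

lemma chords_snoc_Some:
  assumes A: "feasible_on_parabola A" and d: "distinct (xs @ [y])"
    and j: "A (parabola_instance (xs @ [y])) = Some j"
  shows "chords A (xs @ [y]) = insert (xs ! j, y) (chords A xs)"
    and "xs ! j \<in> visible (set xs) (chords A xs) y"
proof -
  let ?M = "matching A (parabola_instance xs)" and ?M' = "matching A (parabola_instance (xs @ [y]))"
  have feas: "feasible A (parabola_instance (xs @ [y]))" "feasible A (parabola_instance xs)"
    using A d by (auto simp: feasible_on_parabola_def)
  have M': "?M' = insert (j, length xs) ?M"
    using j by (auto simp: matching_snoc)
  have jl: "j < length xs"
    using matching_lessD(1)[OF feas(1), of j "length xs"] M' by simp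
  show "chords A (xs @ [y]) = insert (xs ! j, y) (chords A xs)"
    using chords_old[OF A, of xs y] d jl by (simp add: chords_def[of A "xs @ [y]"] M' nth_append)
  have old: "xs ! j' \<noteq> xs ! j \<and> xs ! i' \<noteq> xs ! j \<and>
      inside (xs ! j') (xs ! i') (xs ! j) = inside (xs ! j') (xs ! i') y"
    if e: "(j', i') \<in> ?M" for j' i'
  proof -
    have l: "j' < length xs" "i' < length xs"
      using matching_lessD[OF feas(2) e] by auto
    have "{j', i'} \<inter> {j, length xs} = {}"
      and "\<not> crossing (parabola_instance (xs @ [y])) (j', i') (j, length xs)"
      using feasibleD[OF feas(1), of j' i' j "length xs"] e l M' by auto
    hence ne: "j' \<noteq> j" "i' \<noteq> j" and
      "closed_segment (xs ! j', (xs ! j')\<^sup>2) (xs ! i', (xs ! i')\<^sup>2) \<inter>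
       closed_segment (xs ! j, (xs ! j)\<^sup>2) (y, y\<^sup>2) = {}"
      using l jl by (auto simp: crossing_parabola_instance nth_append)
    moreover have "xs ! j' \<noteq> xs ! j" "xs ! i' \<noteq> xs ! j" "xs ! j' \<noteq> y" "xs ! i' \<noteq> y"
      using ne l jl d by (auto simp: nth_eq_iff_index_eq)
    ultimately show ?thesis
      using parabola_chords_separated by blast
  qed
  thus "xs ! j \<in> visible (set xs) (chords A xs) y"
    using jl by (force simp: visible_def free_def same_side_def chords_def)
qed

section \<open>Lower bound on the expected number of free points\<close>

abbreviation midpt :: "real \<times> real \<Rightarrow> real" where
  "midpt G \<equiv> (fst G + snd G) / 2"

text \<open>Induction on the number of points to come: each contributes a gain of at least 1. The
  midpoint of the current gap is where the next point arrives. The final 4 absorbs the constant in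
  the potential when the game ends.\<close>

lemma adversary_value_free_ge:
  assumes A: "feasible_on_parabola A" and "game_state xs G B"
  shows "9 * adversary_value n (\<lambda>ys. card (free (set ys) (chords A ys))) xs G B \<ge>
    potential (set xs) (chords A xs) (midpt G) (map_option midpt B) + n - 4"
  using assms(2)
proof (induction n arbitrary: xs G B)
  case 0
  show ?case by (auto simp: potential_def split: option.split)
next
  case (Suc n)
  let ?v = "adversary_value n (\<lambda>ys. card (free (set ys) (chords A ys)))"
  obtain l r where G: "G = (l, r)" by fastforce
  define y where "y = (l + r) / 2"
  define t where "t = (l + y) / 2"
  define t' where "t' = (y + r) / 2"
  note st = game_state_next[OF Suc.prems[unfolded G], folded y_def]
  let ?P = "set xs" and ?P' = "insert y (set xs)" and ?M = "chords A xs" and ?M' = "chords A (xs @ [y])"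
  have d: "distinct xs" "{l<..<r} \<inter> ?P = {}" "distinct (xs @ [y])"
    using Suc.prems st(6) by (auto simp: G game_state_def is_gap_def)
  have M: "?M \<subseteq> ?P \<times> ?P"
    using chords_subset A d by blast
  have yg: "y \<in> {l<..<r}" and tg: "t \<in> {l<..<y}" "t' \<in> {y<..<r}" "t \<in> {l<..<r}" "t' \<in> {l<..<r}"
    using st(4,5) by (auto simp: t_def t'_def)
  have IH: "9 * ?v (xs @ [y]) (l, y) (Some (y, r)) \<ge> potential ?P' ?M' t (Some t') + n - 4"
    "9 * ?v (xs @ [y]) (y, r) (Some (l, y)) \<ge> potential ?P' ?M' t' (Some t) + n - 4"
    using Suc.IH[OF st(1)] Suc.IH[OF st(2)] by (simp_all add: t_def t'_def)
  have IH_jump: "9 * ?v (xs @ [y]) H None \<ge> potential ?P' ?M' (midpt H) None + n - 4" if "B = Some H" for H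
    using Suc.IH[OF st(3)[OF that]] by simp
  \<comment> \<open>These match the two branches of the adversary's recursion, for either decision
    of the algorithm on \<open>y\<close>.\<close>
  have avg: "(potential ?P' ?M' t (Some t') + potential ?P' ?M' t' (Some t)) / 2 \<ge> potential ?P ?M y None + 1"
    and jump: "potential ?P' ?M' s None / 2 + (potential ?P' ?M' t (Some t') + potential ?P' ?M' t' (Some t)) / 4
          \<ge> potential ?P ?M y (Some s) + 1" for s
  proof -
    have "(potential ?P' ?M' t (Some t') + potential ?P' ?M' t' (Some t)) / 2 \<ge> potential ?P ?M y None + 1 \<and>
      potential ?P' ?M' s None / 2 + (potential ?P' ?M' t (Some t') + potential ?P' ?M' t' (Some t)) / 4
          \<ge> potential ?P ?M y (Some s) + 1" for s
    proof (cases "A (parabola_instance (xs @ [y]))")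
      case None
      note [simp] = chords_snoc_None[OF A d(1) None]
      note step = potential_step_unmatched[OF finite_set M d(2) yg]
      show ?thesis
        using step(1)[OF tg(3,4)] step(1)[OF tg(4,3)] step(2)[OF tg(3,4), of s]
        by (simp add: field_simps)
    next
      case (Some j)
      note chord = chords_snoc_Some[OF A d(3) Some]
      note step = potential_step_matched[OF finite_set M d(2) yg tg(1,2) chord(2), folded chord(1)]
      show ?thesis
        using step(1) step(2)[of s] by simp
    qed
    thus "(potential ?P' ?M' t (Some t') + potential ?P' ?M' t' (Some t)) / 2 \<ge> potential ?P ?M y None + 1"
      "potential ?P' ?M' s None / 2 + (potential ?P' ?M' t (Some t') + potential ?P' ?M' t' (Some t)) / 4
          \<ge> potential ?P ?M y (Some s) + 1" for s
      by blast+
  qed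
  show ?case
  proof (cases B)
    case None
    thus ?thesis
      using IH avg by (simp add: G Let_def flip: y_def)
  next
    case (Some H)
    thus ?thesis
      using IH IH_jump[OF Some] jump[of "midpt H"]
      by (simp add: G Let_def field_simps flip: y_def)
  qed
qed

section \<open>Expected profit and the bound on the competitive ratio\<close>

lemma profit_parabola_instance:
  assumes A: "feasible_on_parabola A" and d: "distinct xs"
  shows "profit A (parabola_instance xs) = length xs - real (card (free (set xs) (chords A xs)))"
proof -
  let ?m = "matched A (parabola_instance xs)"
  have "feasible A (parabola_instance xs)"
    using assms by (simp add: feasible_on_parabola_def)
  from matching_lessD[OF this] have sub: "?m \<subseteq> {..<length xs}"
    unfolding matched_def by fastforce
  have "fst ` chords A xs \<union> snd ` chords A xs = (!) xs ` ?m"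
    by (force simp: chords_def matched_def)
  hence "free (set xs) (chords A xs) = (!) xs ` {..<length xs} - (!) xs ` ?m"
    by (auto simp: free_def set_conv_nth)
  also have "\<dots> = (!) xs ` ({..<length xs} - ?m)"
    using d sub by (intro inj_on_image_set_diff[symmetric, where C = "{..<length xs}"])
      (auto simp: inj_on_def nth_eq_iff_index_eq)
  finally have "card (free (set xs) (chords A xs)) = card ({..<length xs} - ?m)"
    using d by (auto simp: card_image inj_on_def nth_eq_iff_index_eq)
  also have "\<dots> = length xs - card ?m"
    using sub by (simp add: card_Diff_subset finite_subset)
  finally have "real (card (free (set xs) (chords A xs))) = length xs - real (card ?m)"
    using card_mono[OF _ sub] by (simp add: of_nat_diff)
  moreover have "profit A (parabola_instance xs) = (\<Sum>i\<in>?m. 1)"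
    unfolding profit_def using sub by (intro sum.cong) auto
  ultimately show ?thesis by simp
qed

lemma integrable_profit:
  assumes R: "randomized_online_algorithm \<I> M A" and I: "I \<in> \<I>"
  shows "integrable M (\<lambda>\<omega>. profit (A \<omega>) I)"
proof -
  interpret prob_space M
    using R by (simp add: randomized_online_algorithm_def)
  let ?d = "\<lambda>k \<omega>. A \<omega> (take (Suc k) I)"
  have [measurable]: "?d k \<in> measurable M (count_space UNIV)" if "k \<in> {..<length I}" for k
    using R I that by (simp add: randomized_online_algorithm_def)
  \<comment> \<open>Being matched, expressed by the finitely many decisions on prefixes of
    \<open>I\<close>, which are the ones known to be measurable: \<open>i\<close> is chosen as a
    partner or is matched on arrival.\<close>
  define hit where "hit i \<omega> \<longleftrightarrow> (\<exists>k\<in>{..<length I}. ?d k \<omega> = Some i) \<or> ?d i \<omega> \<noteq> None" for i \<omega>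
  have "profit (A \<omega>) I = (\<Sum>i\<in>{..<length I}. if hit i \<omega> then wt I i else 0)" if "\<omega> \<in> space M" for \<omega>
  proof -
    have "feasible (A \<omega>) I"
      using R I that by (simp add: randomized_online_algorithm_def)
    hence "j < i" if "(j, i) \<in> matching (A \<omega>) I" for j i
      using that by (auto simp: feasible_def)
    hence "matched (A \<omega>) I = {i \<in> {..<length I}. hit i \<omega>}"
      unfolding matched_def hit_def by (fastforce simp: matching_def)
    thus ?thesis
      by (simp add: profit_def sum.If_cases Int_def)
  qed
  moreover have "integrable M (\<lambda>\<omega>. \<Sum>i\<in>{..<length I}. if hit i \<omega> then wt I i else 0)"
  proof (rule Bochner_Integration.integrable_sum)
    fix i assume [measurable]: "i \<in> {..<length I}"
    have "(\<lambda>\<omega>. if hit i \<omega> then wt I i else 0) \<in> borel_measurable M"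
      unfolding hit_def by measurable
    thus "integrable M (\<lambda>\<omega>. if hit i \<omega> then wt I i else 0)"
      by (rule integrable_const_bound[where B = "\<bar>wt I i\<bar>", rotated]) auto
  qed
  ultimately show ?thesis
    by (simp cong: Bochner_Integration.integrable_cong)
qed

text \<open>For every even length the expected number of free points is bounded below by the
  adversary and above by competitiveness. As \<open>c\<close> does not depend on the length, long
  inputs force the bound on the ratio.\<close>

lemma competitive_le:
  assumes R: "randomized_online_algorithm \<I> M A" and sub: "unit_weight_inputs \<subseteq> \<I>"
    and C: "competitive \<I> M A \<rho>"
  shows "\<rho> \<le> 8 / 9"
proof -
  interpret prob_space M
    using R by (simp add: randomized_online_algorithm_def)
  obtain c where c: "\<And>I. I \<in> \<I> \<Longrightarrow> (\<integral>\<omega>. profit (A \<omega>) I \<partial>M) \<ge> \<rho> * opt I - c"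
    using C by (auto simp: competitive_def)
  have feas: "feasible_on_parabola (A \<omega>)" if "\<omega> \<in> space M" for \<omega>
    using R sub that by (intro feasible_on_parabolaI) (auto simp: randomized_online_algorithm_def)
  define u where "u ys \<omega> = real (card (free (set ys) (chords (A \<omega>) ys)))" for ys \<omega>
  have bound: "2 * real m * (\<rho> - 8 / 9) \<le> c + 4 / 9" for m
  proof -
    let ?v = "\<lambda>f. adversary_value (2 * m) f [] (0, 1) None"
    have u: "u ys \<omega> = 2 * m - profit (A \<omega>) (parabola_instance ys)"
      if "distinct ys" "length ys = 2 * m" "\<omega> \<in> space M" for ys \<omega>
      using profit_parabola_instance[OF feas that(1)] that by (simp add: u_def)
    have leaf: "integrable M (u ys)" "(\<integral>\<omega>. u ys \<omega> \<partial>M) \<le> 2 * m - (\<rho> * (2 * m) - c)"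
      if ys: "distinct ys" "length ys = 2 * m" for ys
    proof -
      have I: "parabola_instance ys \<in> \<I>"
        using parabola_instance_inputs[of ys] ys sub by auto
      note int = integrable_profit[OF R I]
      have "integrable M (\<lambda>\<omega>. 2 * m - profit (A \<omega>) (parabola_instance ys))"
        using int by simp
      thus "integrable M (u ys)"
        using u[OF ys] by (simp cong: Bochner_Integration.integrable_cong)
      have "(\<integral>\<omega>. u ys \<omega> \<partial>M) = (\<integral>\<omega>. 2 * m - profit (A \<omega>) (parabola_instance ys) \<partial>M)"
        using u[OF ys] by (intro Bochner_Integration.integral_cong) auto
      also have "\<dots> = 2 * m - (\<integral>\<omega>. profit (A \<omega>) (parabola_instance ys) \<partial>M)"
        using int by (simp add: prob_space)
      finally show "(\<integral>\<omega>. u ys \<omega> \<partial>M) \<le> 2 * m - (\<rho> * (2 * m) - c)"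
        using c[OF I] ys by (simp add: opt_def)
    qed
    have start: "game_state [] (0, 1) None"
      by (simp add: game_state_def is_gap_def)
    have int: "integrable M (\<lambda>\<omega>. ?v (\<lambda>ys. u ys \<omega>))"
      and eq: "(\<integral>\<omega>. ?v (\<lambda>ys. u ys \<omega>) \<partial>M) = ?v (\<lambda>ys. \<integral>\<omega>. u ys \<omega> \<partial>M)"
      using adversary_value_integral[OF start, of "2 * m" M u] leaf(1) by auto
    \<comment> \<open>The game starts with no points and hence with potential 0.\<close>
    have "(2 * real m - 4) / 9 \<le> ?v (\<lambda>ys. u ys \<omega>)" if "\<omega> \<in> space M" for \<omega>
      using adversary_value_free_ge[OF feas[OF that] start, of "2 * m"]
      by (simp add: potential_def free_def visible_def u_def)
    hence "(2 * real m - 4) / 9 \<le> (\<integral>\<omega>. ?v (\<lambda>ys. u ys \<omega>) \<partial>M)"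
      using int by (intro integral_ge_const) auto
    also have "\<dots> \<le> 2 * m - (\<rho> * (2 * m) - c)"
      unfolding eq using leaf(2) by (intro adversary_value_le[OF start]) auto
    finally show ?thesis by (simp add: field_simps)
  qed
  show ?thesis
  proof (rule ccontr)
    assume "\<not> \<rho> \<le> 8 / 9"
    then obtain m where "c + 4 / 9 < real m * (2 * (\<rho> - 8 / 9))"
      using reals_Archimedean3[of "2 * (\<rho> - 8 / 9)"] by auto
    thus False using bound[of m] by (simp add: algebra_simps)
  qed
qed

theorem theorem8:
  fixes M :: "'r measure" and A :: "'r \<Rightarrow> online_algorithm"
  shows "(randomized_online_algorithm ownm_inputs M A \<longrightarrow>
            competitive_ratio ownm_inputs M A \<le> ereal (16 / 17)) \<and>
         (randomized_online_algorithm unit_weight_inputs M A \<longrightarrow>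
            competitive_ratio unit_weight_inputs M A \<le> ereal (16 / 17))"
proof -
  \<comment> \<open>Both input classes contain the unit-weight inputs, and 8/9 is below
    16/17.\<close>
  have "competitive_ratio \<I> M A \<le> ereal (16 / 17)"
    if "randomized_online_algorithm \<I> M A" "unit_weight_inputs \<subseteq> \<I>" for \<I>
    unfolding competitive_ratio_def
    using competitive_le[OF that] by (intro SUP_least) fastforce
  moreover have "unit_weight_inputs \<subseteq> ownm_inputs"
    by (auto simp: unit_weight_inputs_def)
  ultimately show ?thesis by blast
qed

end
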